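(* For all integers $c\geq 6$, $N(c,c)\geq \sqrt{5}^{\,c}$. Moreover, $N(5,5)\geq 55$ and $N(4,4)\geq 25$.
   Context: A normal cover of a graph $G$ is a pair $(\mathcal C,\mathcal S)$ where $\mathcal C$ is a set of cliques of $G$ covering every vertex, $\mathcal S$ is a set of stable sets of $G$ covering every vertex, and every clique in $\mathcal C$ meets every stable set in $\mathcal S$. A $(c,s)$-normal cover is a normal cover whose cliques have at most $c$ vertices and whose stable sets have at most $s$ vertices; a graph is $(c,s)$-normal if it admits one. $N(c,s)$ denotes the maximum number of vertices of a $(c,s)$-normal graph. *)

theory Defs
  imports "HOL-Library.Ramsey" Complex_Main
begin

definition finite_graph :: "'a set \<Rightarrow> 'a set set \<Rightarrow> bool" where
  "finite_graph V E \<longleftrightarrow> finite V \<and> E \<subseteq> [V]\<^bsup>2\<^esup>"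

definition normal_cover :: "'a set \<Rightarrow> 'a set set \<Rightarrow> 'a set set \<Rightarrow> 'a set set \<Rightarrow> bool" where
  "normal_cover V E \<C> \<S> \<longleftrightarrow>
     (\<forall>C\<in>\<C>. C \<subseteq> V \<and> clique C E) \<and> \<Union>\<C> = V \<and>
     (\<forall>S\<in>\<S>. S \<subseteq> V \<and> indep S E) \<and> \<Union>\<S> = V \<and>
     (\<forall>C\<in>\<C>. \<forall>S\<in>\<S>. C \<inter> S \<noteq> {})"

definition cs_normal_cover ::
    "nat \<Rightarrow> nat \<Rightarrow> 'a set \<Rightarrow> 'a set set \<Rightarrow> 'a set set \<Rightarrow> 'a set set \<Rightarrow> bool" where
  "cs_normal_cover c s V E \<C> \<S> \<longleftrightarrow>
     normal_cover V E \<C> \<S> \<and> (\<forall>C\<in>\<C>. card C \<le> c) \<and> (\<forall>S\<in>\<S>. card S \<le> s)"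

definition cs_normal :: "nat \<Rightarrow> nat \<Rightarrow> 'a set \<Rightarrow> 'a set set \<Rightarrow> bool" where
  "cs_normal c s V E \<longleftrightarrow> (\<exists>\<C> \<S>. cs_normal_cover c s V E \<C> \<S>)"

text \<open>Every finite graph has an isomorphic copy with vertices in \<^typ>\<open>nat\<close>.  The maximum below
  is attained, and it bounds graphs over every vertex type: see \<open>finite_normal_orders\<close>,
  \<open>max_normal_attained\<close> and \<open>cs_normal_card_le\<close>.\<close>

definition normal_orders :: "nat \<Rightarrow> nat \<Rightarrow> nat set" where
  "normal_orders c s = {card V |(V :: nat set) E. finite_graph V E \<and> cs_normal c s V E}"

definition max_normal :: "nat \<Rightarrow> nat \<Rightarrow> nat" where
  "max_normal c s = Max (normal_orders c s)"

lemma card_stable_sets_le: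
  assumes fin: "finite V" and cov: "cs_normal_cover c s V E \<C> \<S>" and P: "finite P"
  shows "card {S\<in>\<S>. P \<subseteq> S} \<le> Suc c ^ (s - card P)"
  using P
proof (induction "s - card P" arbitrary: P)
  have C: "C \<subseteq> V" "finite C" "clique C E" "card C \<le> c" if "C \<in> \<C>" for C
    using that cov fin by (auto simp: cs_normal_cover_def normal_cover_def intro: finite_subset)
  have S: "S \<subseteq> V" "finite S" "indep S E" "card S \<le> s" if "S \<in> \<S>" for S
    using that cov fin by (auto simp: cs_normal_cover_def normal_cover_def intro: finite_subset)
  have finS: "finite \<S>"
    by (rule finite_subset[of _ "Pow V"]) (use S fin in auto)
  have meet: "C \<inter> S \<noteq> {}" if "C \<in> \<C>" "S \<in> \<S>" for C S
    using that cov by (auto simp: cs_normal_cover_def normal_cover_def)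
  have all_meet: "card {S\<in>\<S>. P \<subseteq> S} \<le> 1" if *: "\<forall>C\<in>\<C>. C \<inter> P \<noteq> {}" for P
  proof -
    have "S = P" if SP: "S \<in> \<S>" "P \<subseteq> S" for S
    proof (rule ccontr)
      assume "S \<noteq> P"
      then obtain x where x: "x \<in> S" "x \<notin> P" using SP by blast
      then have "x \<in> \<Union>\<C>"
        using cov S(1)[OF SP(1)] by (auto simp: cs_normal_cover_def normal_cover_def)
      then obtain K where K: "K \<in> \<C>" "x \<in> K" by blast
      then obtain y where y: "y \<in> K" "y \<in> P" using * by blast
      have "x \<noteq> y" "y \<in> S" using x y SP(2) by auto
      then have "{x, y} \<in> E" "{x, y} \<notin> E"
        using x y K C(3)[OF K(1)] S(3)[OF SP(1)] unfolding clique_def indep_def by blast+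
      then show False by simp
    qed
    then have "{S\<in>\<S>. P \<subseteq> S} \<subseteq> {P}" by blast
    then show ?thesis using card_mono[of "{P}"] by fastforce
  qed
  {
    case 0
    show ?case
    proof (cases "\<forall>C\<in>\<C>. C \<inter> P \<noteq> {}")
      case True
      then show ?thesis using all_meet 0 by simp
    next
      case False
      then obtain K where K: "K \<in> \<C>" "K \<inter> P = {}" by blast
      have "\<not> P \<subseteq> S" if "S \<in> \<S>" for S
      proof
        assume "P \<subseteq> S"
        moreover have "card S \<le> card P" using S(4)[OF that] 0 by simp
        ultimately have "P = S" using card_seteq[OF S(2)[OF that]] by blast
        then show False using meet[OF K(1) that] K(2) by simp
      qed
      then have "{S\<in>\<S>. P \<subseteq> S} = {}" by blast
      then show ?thesis by (metis card.empty zero_le)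
    qed
  next
    case (Suc k)
    show ?case
    proof (cases "\<forall>C\<in>\<C>. C \<inter> P \<noteq> {}")
      case True
      have "1 \<le> Suc c ^ (s - card P)" by simp
      then show ?thesis using all_meet[OF True] by linarith
    next
      case False
      then obtain K where K: "K \<in> \<C>" "K \<inter> P = {}" by blast
      have "card {S\<in>\<S>. P \<subseteq> S} \<le> card (\<Union>x\<in>K. {S\<in>\<S>. insert x P \<subseteq> S})"
        by (rule card_mono) (use finS C(2)[OF K(1)] meet[OF K(1)] in auto)
      also have "\<dots> \<le> (\<Sum>x\<in>K. card {S\<in>\<S>. insert x P \<subseteq> S})"
        by (rule card_UN_le) (use C(2)[OF K(1)] in auto)
      also have "\<dots> \<le> (\<Sum>x\<in>K. Suc c ^ k)"
      proof (rule sum_mono)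
        fix x assume "x \<in> K"
        then have "x \<notin> P" using K(2) by blast
        then have "card (insert x P) = Suc (card P)" using Suc.prems by simp
        then have k: "k = s - card (insert x P)" using Suc.hyps(2) by linarith
        show "card {S\<in>\<S>. insert x P \<subseteq> S} \<le> Suc c ^ k"
          using Suc.hyps(1)[OF k] Suc.prems k by simp
      qed
      also have "\<dots> \<le> Suc c * Suc c ^ k"
        unfolding sum_constant of_nat_id using C(4)[OF K(1)] by (intro mult_right_mono) auto
      also have "\<dots> = Suc c ^ (s - card P)"
        using Suc.hyps(2) by (metis power_Suc)
      finally show ?thesis .
    qed
  }
qed

lemma cs_normal_order_bound:
  assumes "finite_graph V E" and "cs_normal c s V E"
  shows "card V \<le> Suc c ^ s * s"
proof -
  obtain \<C> \<S> where cov: "cs_normal_cover c s V E \<C> \<S>"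
    using assms(2) by (auto simp: cs_normal_def)
  have fin: "finite V" using assms(1) by (simp add: finite_graph_def)
  have "\<S> \<subseteq> Pow V" and V: "V = \<Union>\<S>" and s: "\<forall>S\<in>\<S>. card S \<le> s"
    using cov by (auto simp: cs_normal_cover_def normal_cover_def)
  then have "finite \<S>" using fin by (metis finite_Pow_iff finite_subset)
  have "card V \<le> (\<Sum>S\<in>\<S>. card S)"
    using card_UN_le[OF \<open>finite \<S>\<close>, of "\<lambda>S. S"] V by simp
  also have "\<dots> \<le> card \<S> * s" using sum_bounded_above[of \<S> card s] s by simp
  also have "\<dots> \<le> Suc c ^ s * s"
    using card_stable_sets_le[OF fin cov, of "{}"] by (intro mult_right_mono) auto
  finally show ?thesis .
qed

lemma finite_normal_orders: "finite (normal_orders c s)"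
  by (rule finite_subset[of _ "{..Suc c ^ s * s}"])
     (auto simp: normal_orders_def dest: cs_normal_order_bound)

lemma max_normal_attained:
  "\<exists>(V :: nat set) E. finite_graph V E \<and> cs_normal c s V E \<and> card V = max_normal c s"
proof -
  have "cs_normal_cover c s ({} :: nat set) {} {} {}"
    by (simp add: cs_normal_cover_def normal_cover_def)
  then have "card ({} :: nat set) \<in> normal_orders c s"
    unfolding normal_orders_def finite_graph_def cs_normal_def by blast
  then have "max_normal c s \<in> normal_orders c s"
    unfolding max_normal_def using finite_normal_orders by (intro Max_in) auto
  then show ?thesis
    unfolding normal_orders_def mem_Collect_eq by metis
qed

lemma cs_normal_card_le:
  fixes V :: "'a set"
  assumes G: "finite_graph V E" and "cs_normal c s V E"
  shows "card V \<le> max_normal c s"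
proof -
  obtain \<C> \<S> where cov: "cs_normal_cover c s V E \<C> \<S>"
    using assms(2) by (auto simp: cs_normal_def)
  have fin: "finite V" and E: "E \<subseteq> [V]\<^bsup>2\<^esup>" using G by (auto simp: finite_graph_def)
  obtain f :: "'a \<Rightarrow> nat" where f: "inj_on f V"
    using finite_imp_inj_to_nat_seg[OF fin] by metis
  define E' where "E' = (`) f ` E"
  have edge: "{f x, f y} \<in> E' \<longleftrightarrow> {x, y} \<in> E" if "x \<in> V" "y \<in> V" for x y
  proof
    assume "{f x, f y} \<in> E'"
    then have "f ` {x, y} \<in> (`) f ` E" by (simp add: E'_def)
    then obtain e where e: "e \<in> E" "f ` {x, y} = f ` e" by (rule imageE)
    moreover have "e \<subseteq> V" using e E by (auto simp: nsets_def)
    ultimately have "{x, y} = e" using inj_on_image_eq_iff[OF f, of "{x, y}" e] that by blast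
    then show "{x, y} \<in> E" using e by simp
  next
    assume "{x, y} \<in> E"
    then have "f ` {x, y} \<in> E'" unfolding E'_def by blast
    then show "{f x, f y} \<in> E'" by simp
  qed
  have sub: "C \<subseteq> V" "clique C E" "card C \<le> c" if "C \<in> \<C>" for C
    using that cov by (auto simp: cs_normal_cover_def normal_cover_def)
  have sub': "S \<subseteq> V" "indep S E" "card S \<le> s" if "S \<in> \<S>" for S
    using that cov by (auto simp: cs_normal_cover_def normal_cover_def)
  have "finite_graph (f ` V) E'"
  proof -
    have "f ` e \<in> [f ` V]\<^bsup>2\<^esup>" if "e \<in> E" for e
    proof -
      have e: "e \<subseteq> V" "finite e" "card e = 2" using that E by (auto simp: nsets_def)
      then have "card (f ` e) = 2" using card_image inj_on_subset[OF f] by metis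
      then show ?thesis using e by (auto simp: nsets_def)
    qed
    then show ?thesis using fin by (auto simp: finite_graph_def E'_def)
  qed
  moreover have "cs_normal_cover c s (f ` V) E' ((`) f ` \<C>) ((`) f ` \<S>)"
  proof -
    have "clique (f ` C) E'" if "C \<in> \<C>" for C
    proof -
      have "{f x, f y} \<in> E'" if "x \<in> C" "y \<in> C" "f x \<noteq> f y" for x y
        using that sub(1,2)[OF \<open>C \<in> \<C>\<close>] edge[of x y] unfolding clique_def by (metis subsetD)
      then show ?thesis unfolding clique_def by blast
    qed
    moreover have "indep (f ` S) E'" if "S \<in> \<S>" for S
    proof -
      have "{f x, f y} \<notin> E'" if "x \<in> S" "y \<in> S" "f x \<noteq> f y" for x y
        using that sub'(1,2)[OF \<open>S \<in> \<S>\<close>] edge[of x y] unfolding indep_def by (metis subsetD)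
      then show ?thesis unfolding indep_def by blast
    qed
    moreover have "card (f ` C) \<le> c" if "C \<in> \<C>" for C
      using sub[OF that] fin by (metis card_image_le finite_subset le_trans)
    moreover have "card (f ` S) \<le> s" if "S \<in> \<S>" for S
      using sub'[OF that] fin by (metis card_image_le finite_subset le_trans)
    moreover have "f ` C \<inter> f ` S \<noteq> {}" if "C \<in> \<C>" "S \<in> \<S>" for C S
    proof -
      have "C \<inter> S \<noteq> {}" using that cov by (auto simp: cs_normal_cover_def normal_cover_def)
      then show ?thesis by blast
    qed
    moreover have "\<Union>((`) f ` \<C>) = f ` V" "\<Union>((`) f ` \<S>) = f ` V"
      using cov by (simp_all add: cs_normal_cover_def normal_cover_def flip: image_Union)
    ultimately show ?thesis
      using sub(1) sub'(1) by (simp add: cs_normal_cover_def normal_cover_def image_mono)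
  qed
  ultimately have "card (f ` V) \<in> normal_orders c s"
    unfolding normal_orders_def cs_normal_def by blast
  then show ?thesis
    unfolding max_normal_def using card_image[OF f] finite_normal_orders by (metis Max_ge)
qed

end

theory Submission
  imports Defs
begin

text \<open>
  A normal cover is the same as two covering families of sets such that every member of the first
  meets every member of the second in exactly one vertex.  If the cliques index the rows and the
  stable sets index the columns of a board, then the vertices partition the board into
  (combinatorial) rectangles, and \<open>N(c,s)\<close> is the largest number of rectangles such that each row
  meets at most \<open>c\<close> and each column at most \<open>s\<close> of them.

  In the 5 by 5 board, the cells off the diagonal are partitioned by the five rectangles
  \<open>{i, i+1} \<times> {i+2, i+4}\<close> (mod 5), and each row and each column meets exactly two of these.
  Replacing the five diagonal cells by disjoint copies of an optimal partition gives
  \<open>N(c+2,s+2) \<ge> 5 + 5 N(c,s)\<close>.  Together with the grids \<open>N(1,1) \<ge> 1\<close> and \<open>N(2,2) \<ge> 4\<close>, this yields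
  10, 55, 280 and 25, 130 for the next odd and even values.
\<close>

text \<open>Constructions can ignore edges: join two vertices when they share a member of
  \<open>\<C>\<close>. An edge inside a member of \<open>\<S>\<close> would then give a crossing
  with two points.\<close>

lemma card_le_max_normal:
  fixes V :: "'a set"
  assumes fin: "finite V" and "\<Union>\<C> = V" and "\<Union>\<S> = V"
    and cross: "\<And>C S. C \<in> \<C> \<Longrightarrow> S \<in> \<S> \<Longrightarrow> \<exists>x. C \<inter> S = {x}"
    and "\<And>C. C \<in> \<C> \<Longrightarrow> card C \<le> c" and "\<And>S. S \<in> \<S> \<Longrightarrow> card S \<le> s"
  shows "card V \<le> max_normal c s"
proof (rule cs_normal_card_le)
  define E where "E = {{x, y} |x y. x \<noteq> y \<and> (\<exists>C\<in>\<C>. x \<in> C \<and> y \<in> C)}"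
  show "finite_graph V E"
    using assms(1,2) by (auto simp: finite_graph_def E_def nsets_def)
  have "clique C E" if "C \<in> \<C>" for C
    using that by (auto simp: clique_def E_def)
  moreover have "indep S E" if "S \<in> \<S>" for S
    unfolding indep_def
  proof (intro ballI impI notI)
    fix x y assume xy: "x \<in> S" "y \<in> S" "x \<noteq> y" and "{x, y} \<in> E"
    then obtain C where C: "C \<in> \<C>" "x \<in> C" "y \<in> C"
      by (auto simp: E_def doubleton_eq_iff)
    then show False using cross[OF C(1) that] xy by (metis IntI singletonD)
  qed
  moreover have "C \<inter> S \<noteq> {}" if "C \<in> \<C>" "S \<in> \<S>" for C S
    using cross[OF that] by blast
  ultimately have "cs_normal_cover c s V E \<C> \<S>"
    using assms(2,3,5,6) by (auto simp: cs_normal_cover_def normal_cover_def)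
  then show "cs_normal c s V E"
    unfolding cs_normal_def by blast
qed

text \<open>The converse passage: two common vertices of a clique and a stable set would be both
  adjacent and non-adjacent.\<close>

lemma max_normal_cross_cover:
  obtains V :: "nat set" and \<C> \<S> where "finite V" "card V = max_normal c s"
    "\<Union>\<C> = V" "\<Union>\<S> = V" "\<And>C S. C \<in> \<C> \<Longrightarrow> S \<in> \<S> \<Longrightarrow> \<exists>x. C \<inter> S = {x}"
    "\<And>C. C \<in> \<C> \<Longrightarrow> card C \<le> c" "\<And>S. S \<in> \<S> \<Longrightarrow> card S \<le> s"
proof -
  obtain V :: "nat set" and E \<C> \<S> where V: "finite_graph V E" "card V = max_normal c s"
    and cov: "cs_normal_cover c s V E \<C> \<S>"
    using max_normal_attained[of c s] unfolding cs_normal_def by blast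
  have "\<exists>x. C \<inter> S = {x}" if "C \<in> \<C>" "S \<in> \<S>" for C S
  proof -
    have "C \<inter> S \<noteq> {}" "clique C E" "indep S E"
      using cov that by (auto simp: cs_normal_cover_def normal_cover_def)
    moreover from this have "x = y" if "x \<in> C \<inter> S" "y \<in> C \<inter> S" for x y
      using that unfolding clique_def indep_def by blast
    ultimately show ?thesis by blast
  qed
  then show thesis
    using V cov
    by (intro that[of V \<C> \<S>]) (auto simp: finite_graph_def cs_normal_cover_def normal_cover_def)
qed

lemma max_normal_ge_grid: "c * s \<le> max_normal c s"
proof -
  have "card ({..<s} \<times> {..<c}) \<le> max_normal c s"
  proof (rule card_le_max_normal)
    show "\<Union>((\<lambda>i. {i} \<times> {..<c}) ` {..<s}) = {..<s} \<times> {..<c}"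
      "\<Union>((\<lambda>j. {..<s} \<times> {j}) ` {..<c}) = {..<s} \<times> {..<c}"
      by auto
    fix C S assume "C \<in> (\<lambda>i. {i} \<times> {..<c}) ` {..<s}" "S \<in> (\<lambda>j. {..<s} \<times> {j}) ` {..<c}"
    then obtain i j where "i < s" "j < c" "C = {i} \<times> {..<c}" "S = {..<s} \<times> {j}" by auto
    then have "C \<inter> S = {(i, j)}" by auto
    then show "\<exists>x. C \<inter> S = {x}" ..
  qed (auto simp: card_cartesian_product)
  then show ?thesis by (simp add: mult.commute)
qed

text \<open>The vertex \<open>(i, Some v)\<close> is the copy of \<open>v\<close> in the \<open>i\<close>-th diagonal cell, and \<open>(i, None)\<close> is the
  rectangle \<open>{i, i+1} \<times> {i+2, i+4}\<close>.\<close>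

definition board_row :: "nat \<Rightarrow> 'a set \<Rightarrow> (nat \<times> 'a option) set" where
  "board_row i C = Pair i ` Some ` C \<union> {(i, None), ((i + 4) mod 5, None)}"

definition board_column :: "nat \<Rightarrow> 'a set \<Rightarrow> (nat \<times> 'a option) set" where
  "board_column j S = Pair j ` Some ` S \<union> {((j + 3) mod 5, None), ((j + 1) mod 5, None)}"

text \<open>Rectangle \<open>k\<close> occupies rows \<open>k\<close> and \<open>k + 1\<close>. For
  \<open>k\<close> equal to \<open>j + 3\<close> or \<open>j + 1\<close> these rows are
  \<open>j + 3\<close>, \<open>j + 4\<close>, \<open>j + 1\<close>, \<open>j + 2\<close> mod 5:
  every row other than \<open>j\<close> exactly once, and never row \<open>j\<close>.\<close>

lemma board_row_Int_column:
  assumes "i < 5" and "j < 5" and "C \<inter> S = {x}"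
  shows "\<exists>y. board_row i C \<inter> board_column j S = {y}"
proof (cases "i = j")
  case True
  have "i \<in> {0, 1, 2, 3, 4}" using assms(1) by auto
  then have "board_row i C \<inter> board_column j S = Pair i ` Some ` (C \<inter> S)"
    unfolding board_row_def board_column_def True[symmetric] by auto
  then show ?thesis using assms(3) by simp
next
  case False
  have "i \<in> {0, 1, 2, 3, 4}" "j \<in> {0, 1, 2, 3, 4}" using assms(1,2) by auto
  then have "\<exists>k. {i, (i + 4) mod 5} \<inter> {(j + 3) mod 5, (j + 1) mod 5} = {k}"
    using False by auto
  then obtain k where "{i, (i + 4) mod 5} \<inter> {(j + 3) mod 5, (j + 1) mod 5} = {k}" ..
  \<comment> \<open>Off the diagonal the \<open>Some\<close> parts carry different first
    coordinates, so only rectangles can be shared.\<close>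
  moreover have "board_row i C \<inter> board_column j S =
      (\<lambda>k. (k, None)) ` ({i, (i + 4) mod 5} \<inter> {(j + 3) mod 5, (j + 1) mod 5})"
    using False unfolding board_row_def board_column_def by auto
  ultimately show ?thesis by simp
qed

lemma max_normal_add_2:
  assumes "max_normal c s > 0"
  shows "5 + 5 * max_normal c s \<le> max_normal (c + 2) (s + 2)"
proof -
  obtain V :: "nat set" and \<C> \<S> where V: "finite V" "card V = max_normal c s"
    and cov: "\<Union>\<C> = V" "\<Union>\<S> = V"
    and cross: "\<And>C S. C \<in> \<C> \<Longrightarrow> S \<in> \<S> \<Longrightarrow> \<exists>x. C \<inter> S = {x}"
    and bound: "\<And>C. C \<in> \<C> \<Longrightarrow> card C \<le> c" "\<And>S. S \<in> \<S> \<Longrightarrow> card S \<le> s"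
    by (rule max_normal_cross_cover[of c s]) (rule that)
  \<comment> \<open>Positivity supplies one member of each family; without them there would be no
    rows or columns to cover the \<open>None\<close> vertices.\<close>
  have "V \<noteq> {}" using V assms by auto
  then obtain C\<^sub>0 S\<^sub>0 where ne: "C\<^sub>0 \<in> \<C>" "S\<^sub>0 \<in> \<S>" using cov by blast
  have copy: "card (Pair i ` Some ` X) = card X" for i :: nat and X :: "nat set"
    by (simp add: card_image inj_on_def)
  define W where "W = {..<5::nat} \<times> insert None (Some ` V)"
  have "card W \<le> max_normal (c + 2) (s + 2)"
  proof (rule card_le_max_normal)
    let ?R = "case_prod board_row ` ({..<5} \<times> \<C>)"
    let ?K = "case_prod board_column ` ({..<5} \<times> \<S>)"
    show "finite W" using V(1) by (simp add: W_def)
    show "\<Union>?R = W"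
    proof
      show "\<Union>?R \<subseteq> W" using cov(1) by (auto simp: board_row_def W_def image_iff)
      show "W \<subseteq> \<Union>?R"
      proof
        fix w assume w: "w \<in> W"
        then obtain i u where iu: "w = (i, u)" "i < 5" by (auto simp: W_def)
        have "\<exists>C\<in>\<C>. w \<in> board_row i C"
        proof (cases u)
          case None
          then show ?thesis using iu ne(1) by (auto simp: board_row_def)
        next
          case (Some v)
          then obtain C where "C \<in> \<C>" "v \<in> C" using w iu cov(1) by (auto simp: W_def)
          then show ?thesis using Some iu by (auto simp: board_row_def)
        qed
        then show "w \<in> \<Union>?R" using iu(2) by force
      qed
    qed
    show "\<Union>?K = W"
    proof
      show "\<Union>?K \<subseteq> W" using cov(2) by (auto simp: board_column_def W_def image_iff)
      show "W \<subseteq> \<Union>?K"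
      proof
        fix w assume w: "w \<in> W"
        then obtain i u where iu: "w = (i, u)" "i < 5" by (auto simp: W_def)
        have "\<exists>j<5. \<exists>S\<in>\<S>. w \<in> board_column j S"
        proof (cases u)
          case None
          \<comment> \<open>Column \<open>i + 4\<close> is one of the two columns of rectangle
            \<open>i\<close>.\<close>
          have "i = ((i + 4) mod 5 + 1) mod 5" using iu(2) by presburger
          then have "w \<in> board_column ((i + 4) mod 5) S\<^sub>0"
            using None iu by (simp add: board_column_def)
          then show ?thesis using ne(2) by (metis mod_less_divisor zero_less_numeral)
        next
          case (Some v)
          then obtain S where "S \<in> \<S>" "v \<in> S" using w iu cov(2) by (auto simp: W_def)
          then show ?thesis using Some iu by (auto simp: board_column_def)
        qed
        then show "w \<in> \<Union>?K" by force
      qed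
    qed
    show "\<exists>x. R \<inter> K = {x}" if R: "R \<in> ?R" and K: "K \<in> ?K" for R K
    proof -
      obtain i j C S where *: "i < 5" "j < 5" "C \<in> \<C>" "S \<in> \<S>"
        and RK: "R = board_row i C" "K = board_column j S"
        using R K by auto
      obtain x where "C \<inter> S = {x}" using cross[OF *(3,4)] ..
      then show ?thesis unfolding RK by (rule board_row_Int_column[OF *(1,2)])
    qed
    show "card R \<le> c + 2" if R: "R \<in> ?R" for R
    proof -
      obtain i C where "C \<in> \<C>" "R = Pair i ` Some ` C \<union> {(i, None), ((i + 4) mod 5, None)}"
        using R by (auto simp: board_row_def)
      then show ?thesis
        using card_Un_le[of "Pair i ` Some ` C" "{(i, None), ((i + 4) mod 5, None)}"] bound(1)[of C]
        by (simp add: copy card_insert_if split: if_splits)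
    qed
    show "card K \<le> s + 2" if K: "K \<in> ?K" for K
    proof -
      obtain j S where "S \<in> \<S>"
          "K = Pair j ` Some ` S \<union> {((j + 3) mod 5, None), ((j + 1) mod 5, None)}"
        using K by (auto simp: board_column_def)
      then show ?thesis
        using card_Un_le[of "Pair j ` Some ` S" "{((j + 3) mod 5, None), ((j + 1) mod 5, None)}"]
          bound(2)[of S]
        by (simp add: copy card_insert_if split: if_splits)
    qed
  qed
  moreover have "card W = 5 + 5 * max_normal c s"
    using V by (simp add: W_def card_cartesian_product card_image)
  ultimately show ?thesis by simp
qed

text \<open>Raising \<open>c\<close> by 2 gains a factor of at least \<open>5 = sqrt 5 ^ 2\<close>,
  so one base case per parity suffices. The odd chain starts at 7 because 55 lies just below
  \<open>sqrt 5 ^ 5\<close>.\<close>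

lemma sqrt_5_power_le_max_normal:
  assumes "c \<ge> 6" and "max_normal 6 6 \<ge> 125" and "max_normal 7 7 \<ge> 280"
  shows "sqrt 5 ^ c \<le> real (max_normal c c)"
  using assms(1)
proof (induction c rule: less_induct)
  case (less c)
  have pow6: "sqrt 5 ^ 6 = (125 :: real)"
    using power_mult[of "sqrt 5" 2 3] by simp
  consider "c = 6" | "c = 7" | "c \<ge> 8" using less.prems by linarith
  then show ?case
  proof cases
    case 1
    then show ?thesis using pow6 assms(2) by simp
  next
    case 2
    \<comment> \<open>The constant is \<open>280 / 125\<close>, and its square \<open>5.0176\<close>
      just exceeds 5.\<close>
    have "sqrt 5 \<le> 2.24" by (rule real_le_lsqrt) (auto simp: power2_eq_square)
    moreover have "sqrt 5 ^ 7 = sqrt 5 * (125 :: real)"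
      using power_Suc[of "sqrt 5" 6] pow6 by simp
    ultimately show ?thesis using 2 assms(3) by simp
  next
    case 3
    define d where "d = c - 2"
    have d: "c = d + 2" "d \<ge> 6" "d < c" using 3 by (auto simp: d_def)
    then have IH: "sqrt 5 ^ d \<le> real (max_normal d d)" using less.IH by blast
    have "0 < sqrt 5 ^ d" by simp
    then have "0 < max_normal d d" using IH by linarith
    then have "5 + 5 * max_normal d d \<le> max_normal c c"
      using max_normal_add_2 d(1) by blast
    moreover have "sqrt 5 ^ c = 5 * sqrt 5 ^ d"
      by (simp add: d(1) power_add)
    ultimately show ?thesis using IH by linarith
  qed
qed

theorem theorem2:
  shows "(\<forall>c::nat. c \<ge> 6 \<longrightarrow> real (max_normal c c) \<ge> sqrt 5 ^ c)
    \<and> max_normal 5 5 \<ge> 55 \<and> max_normal 4 4 \<ge> 25"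
proof -
  have N1: "max_normal 1 1 \<ge> 1" and N2: "max_normal 2 2 \<ge> 4"
    using max_normal_ge_grid[of 1 1] max_normal_ge_grid[of 2 2] by simp_all
  have N3: "max_normal 3 3 \<ge> 10" using max_normal_add_2[of 1 1] N1 by (simp add: numeral_3_eq_3)
  have N4: "max_normal 4 4 \<ge> 25" using max_normal_add_2[of 2 2] N2 by simp
  have N5: "max_normal 5 5 \<ge> 55" using max_normal_add_2[of 3 3] N3 by simp
  have N6: "max_normal 6 6 \<ge> 125" using max_normal_add_2[of 4 4] N4 by simp
  have N7: "max_normal 7 7 \<ge> 280" using max_normal_add_2[of 5 5] N5 by simp
  show ?thesis
    using sqrt_5_power_le_max_normal N4 N5 N6 N7 by blast
qed

end
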